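(* Let $\alpha>\frac12$, let $a>0$ and let $g$ be a function on $\mathbb{R}$. The following assertions are equivalent: (i) $g=\mathcal{F}_{B,S}^{\alpha}(f)$ for some $f\in\mathcal{D}_a(\mathbb{R})$; (ii) $g$ extends to an entire function $\tilde g$ on $\mathbb{C}$ for which there exists $h\in\mathcal{F}_{B,S}^{\alpha-1}(\mathcal{D}_a(\mathbb{R}))$ such that $$\tilde g(z)=\alpha\,\frac{h'(z)-h'(0)}{z}\qquad\text{for all } z\in\mathbb{C}\setminus\{0\},$$ where elements of $\mathcal{F}_{B,S}^{\alpha-1}(\mathcal{D}_a(\mathbb{R}))$ are identified with their extensions to entire functions.
   Context: $\mathcal{D}_a(\mathbb{R})$ is the space of infinitely differentiable (complex-valued) functions on $\mathbb{R}$ with support in $[-a,a]$. For $\beta>-\frac12$, the Bessel-Struve kernel is $S_\lambda^\beta(x)=\frac{2\Gamma(\beta+1)}{\sqrt\pi\,\Gamma(\beta+\frac12)}\int_0^1(1-t^2)^{\beta-\frac12}e^{\lambda xt}\,dt$ and the Bessel-Struve transform is $\mathcal{F}_{B,S}^\beta(f)(\lambda)=\int_{\mathbb{R}}f(x)\,S_{-i\lambda}^\beta(x)\,|x|^{2\beta+1}dx$, $\lambda\in\mathbb{R}$; for compactly supported smooth $f$ the same formula for $\lambda\in\mathbb{C}$ gives its entire extension. *)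

theory Defs
  imports "HOL-Complex_Analysis.Complex_Analysis"
begin

definition infinitely_differentiable :: "(real \<Rightarrow> complex) \<Rightarrow> bool" where
  "infinitely_differentiable f \<longleftrightarrow>
     (\<forall>n x. ((\<lambda>u t. vector_derivative u (at t)) ^^ n) f differentiable (at x))"

definition test_functions :: "real \<Rightarrow> (real \<Rightarrow> complex) set" where
  "test_functions a =
     {f. infinitely_differentiable f \<and> closure (support_on UNIV f) \<subseteq> {-a..a}}"

text \<open>For \<open>-1/2 < \<beta> < 1/2\<close> the weight \<open>(1 - t\<^sup>2) powr (\<beta> - 1/2)\<close> is
  unbounded near \<open>t = 1\<close>, but Lebesgue integrable.\<close>

definition bessel_struve_kernel :: "real \<Rightarrow> complex \<Rightarrow> real \<Rightarrow> complex" where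
  "bessel_struve_kernel \<beta> \<mu> x =
     of_real (2 * Gamma (\<beta> + 1) / (sqrt pi * Gamma (\<beta> + 1/2))) *
     (LINT t:{0..1}|lborel.
        of_real ((1 - t\<^sup>2) powr (\<beta> - 1/2)) * exp (\<mu> * of_real x * of_real t))"

definition bessel_struve_transform :: "real \<Rightarrow> (real \<Rightarrow> complex) \<Rightarrow> real \<Rightarrow> complex" where
  "bessel_struve_transform \<beta> f y =
     (LINT x|lborel. f x * bessel_struve_kernel \<beta> (- \<i> * of_real y) x
        * of_real (\<bar>x\<bar> powr (2 * \<beta> + 1)))"

definition entire_extension :: "(real \<Rightarrow> complex) \<Rightarrow> (complex \<Rightarrow> complex) \<Rightarrow> bool" where
  "entire_extension g G \<longleftrightarrow> G holomorphic_on UNIV \<and> (\<forall>x. G (of_real x) = g x)"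

text \<open>The space of Bessel-Struve transforms of functions in \<open>test_functions a\<close>, each
  identified with its (unique) extension to an entire function.\<close>

definition entire_bessel_struve_image :: "real \<Rightarrow> real \<Rightarrow> (complex \<Rightarrow> complex) set" where
  "entire_bessel_struve_image \<beta> a =
     {h. \<exists>f\<in>test_functions a. entire_extension (bessel_struve_transform \<beta> f) h}"

end

theory Submission
  imports Defs
begin

text \<open>The kernel of order \<open>\<beta>\<close> is \<open>S\<^sub>\<beta>(\<lambda>x)\<close> for an entire function \<open>S\<^sub>\<beta>\<close>. Put \<open>\<beta> = \<alpha> - 1\<close>. Integrating the
  derivative of \<open>(1 - t\<^sup>2)\<^bsup>\<beta> + 1/2\<^esup> e\<^bsup>wt\<^esup>\<close> over \<open>[0, 1]\<close> gives
  \<open>S\<^sub>\<beta>'(w) - S\<^sub>\<beta>'(0) = w S\<^sub>\<alpha>(w) / (2\<alpha>)\<close>. Hence, if \<open>h\<close> is the entire extension of the transform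
  of \<open>f\<close> of order \<open>\<alpha> - 1\<close>, differentiation under the integral sign shows that
  \<open>\<alpha> (h'(z) - h'(0)) / z\<close> is \<open>-1/2\<close> times the entire extension of the transform of \<open>f\<close> of
  order \<open>\<alpha>\<close>. Both implications follow by rescaling \<open>f\<close> by \<open>-2\<close> or \<open>-1/2\<close>.\<close>

section \<open>Integrals of an integrable density against an entire function\<close>

lemma integrable_mult_bounded_on_support:
  fixes k g :: "'a \<Rightarrow> complex"
  assumes "integrable M k" and "g \<in> borel_measurable M"
    and "\<And>t. k t \<noteq> 0 \<Longrightarrow> norm (g t) \<le> C"
  shows "integrable M (\<lambda>t. k t * g t)"
proof (rule Bochner_Integration.integrable_bound)
  show "integrable M (\<lambda>t. of_real C * k t)"
    using assms by simp
  show "(\<lambda>t. k t * g t) \<in> borel_measurable M"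
    using assms by simp
  have "norm (k t * g t) \<le> norm (of_real C * k t)" for t
  proof (cases "k t = 0")
    case False
    then have "norm (g t) \<le> \<bar>C\<bar>"
      using assms(3)[OF False] by linarith
    then show ?thesis
      by (simp add: norm_mult mult.commute mult_right_mono)
  qed simp
  then show "AE t in M. norm (k t * g t) \<le> norm (of_real C * k t)"
    by simp
qed

lemma holomorphic_bounded_on_cball:
  assumes "s holomorphic_on UNIV"
  obtains C where "\<And>w. norm w \<le> R \<Longrightarrow> norm (s w) \<le> C"
proof -
  have "compact (s ` cball 0 R)"
    using assms by (intro compact_continuous_image holomorphic_on_imp_continuous_on)
      (auto intro: holomorphic_on_subset)
  then have "bounded (s ` cball 0 R)"
    by (rule compact_imp_bounded)
  then show ?thesis
    using that unfolding bounded_iff by (metis image_eqI mem_cball_0)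
qed

lemma holomorphic_measurable_comp:
  assumes "s holomorphic_on UNIV" and "\<phi> \<in> borel_measurable M"
  shows "(\<lambda>t. s (\<phi> t)) \<in> borel_measurable M"
  using measurable_compose[OF assms(2) borel_measurable_continuous_onI]
    holomorphic_on_imp_continuous_on[OF assms(1)] by blast

text \<open>Used twice: for the kernel, with \<open>s = exp\<close>, \<open>\<phi> t = t\<close> and
  \<open>B = 1\<close>; and for the transform, with \<open>s\<close> the kernel,
  \<open>\<phi> x = - \<i> * x\<close> and \<open>B = a\<close>. The bound on \<open>\<phi>\<close>
  is confined to the points where \<open>k\<close> is nonzero, so that compact support can be
  carried by the density while the integral runs over the whole line.\<close>

context
  fixes M :: "'a measure" and k \<phi> :: "'a \<Rightarrow> complex" and s :: "complex \<Rightarrow> complex" and B :: real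
  assumes s: "s holomorphic_on UNIV"
    and k: "integrable M k"
    and \<phi>[measurable]: "\<phi> \<in> borel_measurable M"
    and B: "\<And>t. k t \<noteq> 0 \<Longrightarrow> norm (\<phi> t) \<le> B"
begin

lemma integrable_mult_entire:
  "integrable M (\<lambda>t. k t * s (z * \<phi> t))"
proof -
  obtain C where C: "\<And>w. norm w \<le> norm z * B \<Longrightarrow> norm (s w) \<le> C"
    using holomorphic_bounded_on_cball[OF s] by blast
  show ?thesis
    by (rule integrable_mult_bounded_on_support[OF k, where C = C])
      (auto intro!: holomorphic_measurable_comp[OF s] C mult_left_mono B simp: norm_mult)
qed

lemma integrable_mult_deriv_entire:
  "integrable M (\<lambda>t. k t * (\<phi> t * deriv s (z * \<phi> t)))"
proof -
  have s': "deriv s holomorphic_on UNIV"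
    using s by (simp add: holomorphic_deriv)
  obtain C where C: "\<And>w. norm w \<le> norm z * B \<Longrightarrow> norm (deriv s w) \<le> C"
    using holomorphic_bounded_on_cball[OF s'] by blast
  have meas[measurable]: "(\<lambda>t. deriv s (z * \<phi> t)) \<in> borel_measurable M"
    by (rule holomorphic_measurable_comp[OF s']) simp
  show ?thesis
  proof (rule integrable_mult_bounded_on_support[OF k, where C = "B * C"])
    fix t assume "k t \<noteq> 0"
    then have b: "norm (\<phi> t) \<le> B"
      by (rule B)
    then have "norm (deriv s (z * \<phi> t)) \<le> C"
      by (intro C) (auto simp: norm_mult intro: mult_left_mono)
    then show "norm (\<phi> t * deriv s (z * \<phi> t)) \<le> B * C"
      unfolding norm_mult using b by (meson mult_mono norm_ge_zero order_trans)
  qed simp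
qed

text \<open>The first-order Taylor remainder of \<open>s\<close> is quadratic, with one constant for
  all arguments in a fixed ball. Integrating it against \<open>k\<close> shows that the difference
  quotient misses the claimed derivative by at most a multiple of \<open>norm h\<close>.\<close>

lemma has_field_derivative_integral_entire:
  "((\<lambda>z. LINT t|M. k t * s (z * \<phi> t)) has_field_derivative
    (LINT t|M. k t * (\<phi> t * deriv s (z * \<phi> t)))) (at z)"
proof -
  let ?F = "\<lambda>z. LINT t|M. k t * s (z * \<phi> t)"
  let ?D = "LINT t|M. k t * (\<phi> t * deriv s (z * \<phi> t))"
  \<comment> \<open>Bounds the arguments \<open>z * \<phi> t\<close> and
    \<open>(z + h) * \<phi> t\<close> for \<open>norm h < 1\<close>, wherever
    \<open>k t \<noteq> 0\<close>.\<close>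
  define R where "R = (norm z + 1) * B"
  have hol: "(deriv ^^ n) s holomorphic_on UNIV" for n
    using s by (simp add: holomorphic_higher_deriv)
  obtain C where C: "\<And>w. norm w \<le> R \<Longrightarrow> norm ((deriv ^^ 2) s w) \<le> C"
    using holomorphic_bounded_on_cball[OF hol] by blast
  have taylor: "norm (s v - s w - deriv s w * (v - w)) \<le> C * norm (v - w) ^ 2"
    if "norm v \<le> R" "norm w \<le> R" for v w
  proof -
    have "norm ((deriv ^^ 0) s v - (\<Sum>i\<le>1. (deriv ^^ i) s w * (v - w) ^ i / fact i))
        \<le> C * norm (v - w) ^ Suc 1 / fact 1"
    proof (rule complex_Taylor[where S = "cball 0 R" and f = "\<lambda>i. (deriv ^^ i) s"])
      show "((deriv ^^ i) s has_field_derivative (deriv ^^ Suc i) s x) (at x within cball 0 R)"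
        for i x
        using holomorphic_derivI[OF hol open_UNIV, of x i] by (auto intro: DERIV_subset)
      show "norm ((deriv ^^ Suc 1) s x) \<le> C" if "x \<in> cball 0 R" for x
        using C[of x] that by (simp add: numeral_2_eq_2)
    qed (use that in auto)
    then show ?thesis
      by (simp add: numeral_2_eq_2 algebra_simps)
  qed
  \<comment> \<open>The pointwise remainder bound \<open>C * (norm h * B)^2 * norm (k t)\<close>,
    integrated, with \<open>(norm h)^2\<close> split off.\<close>
  define K where "K = C * B\<^sup>2 * (LINT t|M. norm (k t))"
  have est: "norm ((?F (z + h) - ?F z) / h - ?D) \<le> K * norm h" if h: "h \<noteq> 0" "norm h < 1" for h
  proof -
    \<comment> \<open>The Taylor remainder under the integral; its integral is
      \<open>?F (z + h) - ?F z - h * ?D\<close>.\<close>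
    let ?r = "\<lambda>t. k t * (s ((z + h) * \<phi> t) - s (z * \<phi> t) - deriv s (z * \<phi> t) * (h * \<phi> t))"
    have eq: "?r t = k t * s ((z + h) * \<phi> t) - k t * s (z * \<phi> t)
        - h * (k t * (\<phi> t * deriv s (z * \<phi> t)))" for t
      by (simp add: algebra_simps)
    have int: "integrable M ?r"
      unfolding eq by (intro Bochner_Integration.integrable_diff integrable_mult_right
        integrable_mult_entire integrable_mult_deriv_entire)
    have "(LINT t|M. ?r t) = ?F (z + h) - ?F z - h * ?D"
      unfolding eq
      by (subst Bochner_Integration.integral_diff;
          (intro Bochner_Integration.integrable_diff integrable_mult_right
            integrable_mult_entire integrable_mult_deriv_entire)?)
        (simp add: integrable_mult_entire)
    moreover have "norm (LINT t|M. ?r t) \<le> (LINT t|M. C * B\<^sup>2 * (norm h)\<^sup>2 * norm (k t))"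
    proof (rule order_trans[OF Bochner_Integration.integral_norm_bound
          Bochner_Integration.integral_mono[OF integrable_norm[OF int]]])
      show "integrable M (\<lambda>t. C * B\<^sup>2 * (norm h)\<^sup>2 * norm (k t))"
        using k by simp
      fix t
      show "norm (?r t) \<le> C * B\<^sup>2 * (norm h)\<^sup>2 * norm (k t)"
      proof (cases "k t = 0")
        case False
        then have b: "norm (\<phi> t) \<le> B"
          by (rule B)
        \<comment> \<open>\<open>B\<close> and \<open>C\<close> come without a sign; a point with
          \<open>k t \<noteq> 0\<close> forces both to be nonnegative.\<close>
        have B0: "0 \<le> B"
          using b norm_ge_zero order_trans by blast
        have bd: "norm ((z + h) * \<phi> t) \<le> R" "norm (z * \<phi> t) \<le> R"
          unfolding norm_mult R_def using b h norm_triangle_ineq[of z h]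
          by (intro mult_mono; simp)+
        have C0: "0 \<le> C"
          using C[OF bd(2)] norm_ge_zero order_trans by blast
        have "norm (s ((z + h) * \<phi> t) - s (z * \<phi> t) - deriv s (z * \<phi> t) * (h * \<phi> t))
            \<le> C * norm (h * \<phi> t) ^ 2"
          using taylor[OF bd] by (simp add: algebra_simps)
        also have "\<dots> \<le> C * (norm h * B)\<^sup>2"
          using b C0 by (intro mult_left_mono power_mono) (auto simp: norm_mult intro: mult_left_mono)
        finally have "norm (?r t) \<le> norm (k t) * (C * (norm h * B)\<^sup>2)"
          unfolding norm_mult by (rule mult_left_mono) simp
        then show ?thesis
          by (simp only: power_mult_distrib mult_ac)
      qed simp
    qed
    ultimately have "norm (?F (z + h) - ?F z - h * ?D) \<le> K * (norm h)\<^sup>2"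
      by (simp add: K_def mult_ac)
    moreover have "(?F (z + h) - ?F z) / h - ?D = (?F (z + h) - ?F z - h * ?D) / h"
      using h by (simp add: diff_divide_distrib)
    ultimately show ?thesis
      using h by (simp add: norm_divide divide_le_eq power2_eq_square mult_ac)
  qed
  show ?thesis
    unfolding DERIV_def
  proof (rule LIM_zero_cancel, rule Lim_null_comparison)
    show "\<forall>\<^sub>F h in at 0. norm ((?F (z + h) - ?F z) / h - ?D) \<le> K * norm h"
      unfolding eventually_at using est by (intro exI[of _ 1]) auto
    show "((\<lambda>h. K * norm h) \<longlongrightarrow> 0) (at (0::complex))"
      by (auto intro!: tendsto_eq_intros)
  qed
qed

end

section \<open>The kernel as an entire function, and the recurrence in its order\<close>

definition bessel_struve_weight :: "real \<Rightarrow> real \<Rightarrow> real" where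
  "bessel_struve_weight \<beta> t = indicator {0..1} t * (1 - t\<^sup>2) powr (\<beta> - 1/2)"

definition bessel_struve_const :: "real \<Rightarrow> real" where
  "bessel_struve_const \<beta> = 2 * Gamma (\<beta> + 1) / (sqrt pi * Gamma (\<beta> + 1/2))"

definition bessel_struve_entire :: "real \<Rightarrow> complex \<Rightarrow> complex" where
  "bessel_struve_entire \<beta> w =
     of_real (bessel_struve_const \<beta>) *
     (LINT t|lborel. of_real (bessel_struve_weight \<beta> t) * exp (w * of_real t))"

lemma bessel_struve_kernel_eq:
  "bessel_struve_kernel \<beta> \<mu> x = bessel_struve_entire \<beta> (\<mu> * of_real x)"
  by (simp add: bessel_struve_kernel_def bessel_struve_entire_def bessel_struve_const_def
      set_lebesgue_integral_def bessel_struve_weight_def scaleR_conv_of_real mult.assoc)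

text \<open>Both Gamma factors shift by Gamma(x+1) = x Gamma(x). The hypothesis keeps the arguments
  off the poles and makes the cancelled factor \<open>\<beta> + 1/2\<close> nonzero.\<close>

lemma bessel_struve_const_Suc:
  assumes "\<beta> > -1/2"
  shows "bessel_struve_const (\<beta> + 1) * (\<beta> + 1/2) = bessel_struve_const \<beta> * (\<beta> + 1)"
proof -
  have "Gamma (\<beta> + 1 + 1) = (\<beta> + 1) * Gamma (\<beta> + 1)"
    using assms by (intro Gamma_plus1) (auto simp: nonpos_Ints_def)
  moreover have "Gamma (\<beta> + 1 + 1/2) = (\<beta> + 1/2) * Gamma (\<beta> + 1/2)"
    using assms Gamma_plus1[of "\<beta> + 1/2"] by (auto simp: nonpos_Ints_def add_ac)
  moreover have "2 * ((\<beta> + 1) * x) / (y * (c * z)) * c = 2 * x / (y * z) * (\<beta> + 1)"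
    if "c \<noteq> 0" for x y z c :: real
    using that by simp
  ultimately show ?thesis
    using assms by (simp only: bessel_struve_const_def)
qed

text \<open>The antiderivative is continuous up to \<open>t = 1\<close> because
  \<open>p + 1 > 0\<close>, so the interior form of the fundamental theorem applies despite the
  singularity for negative \<open>p\<close>; nonnegativity upgrades the gauge integral to an
  absolutely convergent one.\<close>

lemma integrable_one_minus_powr:
  fixes p :: real
  assumes "p > -1"
  shows "set_integrable lborel {0..1} (\<lambda>t. (1 - t) powr p)"
proof -
  have "((\<lambda>t. (1 - t) powr p) has_integral
      (- 1 / (p + 1) * (1 - 1) powr (p + 1) - (- 1 / (p + 1) * (1 - 0) powr (p + 1)))) {0..1::real}"
  proof (rule fundamental_theorem_of_calculus_interior)
    show "continuous_on {0..1} (\<lambda>t. - 1 / (p + 1) * (1 - t) powr (p + 1))"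
      using assms by (auto intro!: continuous_intros continuous_on_powr')
    fix t :: real assume t: "t \<in> {0<..<1}"
    have "((\<lambda>t. (1 - t) powr (p + 1)) has_real_derivative - (p + 1) * (1 - t) powr p) (at t)"
      using t by (auto intro!: derivative_eq_intros simp: powr_diff field_simps)
    from DERIV_cmult[OF this, of "- 1 / (p + 1)"]
    show "((\<lambda>t. - 1 / (p + 1) * (1 - t) powr (p + 1)) has_vector_derivative (1 - t) powr p) (at t)"
      using assms unfolding has_real_derivative_iff_has_vector_derivative[symmetric]
      by (simp del: minus_add_distrib)
  qed simp
  then have "(\<lambda>t. (1 - t) powr p) absolutely_integrable_on {0..1}"
    by (intro nonnegative_absolutely_integrable_1) (auto simp: integrable_on_def)
  \<comment> \<open>Absolute integrability refers to the completed measure; Borel measurability of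
    the integrand brings it back to \<open>lborel\<close>.\<close>
  then show ?thesis
    unfolding set_integrable_def
    by (subst integrable_completion[symmetric]) auto
qed

text \<open>In \<open>1 - t\<^sup>2 = (1 + t) * (1 - t)\<close> only the second factor can produce a
  singularity on \<open>[0, 1]\<close>. As \<open>1 + t\<close> lies in \<open>[1, 2]\<close>, its
  power is at most \<open>2 powr ?p\<close> for \<open>?p \<ge> 0\<close> and at most 1
  otherwise.\<close>

lemma integrable_bessel_struve_weight:
  assumes "\<beta> > -1/2"
  shows "integrable lborel (bessel_struve_weight \<beta>)"
proof -
  let ?p = "\<beta> - 1/2"
  have "integrable lborel (\<lambda>t. max 1 (2 powr ?p) * (indicator {0..1} t *\<^sub>R (1 - t) powr ?p))"
    using integrable_one_minus_powr[of ?p] assms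
    unfolding set_integrable_def by (intro integrable_mult_right) auto
  then show ?thesis
  proof (rule Bochner_Integration.integrable_bound)
    show "bessel_struve_weight \<beta> \<in> borel_measurable lborel"
      unfolding bessel_struve_weight_def by measurable
    have "norm (bessel_struve_weight \<beta> t)
        \<le> norm (max 1 (2 powr ?p) * (indicator {0..1} t *\<^sub>R (1 - t) powr ?p))" for t
    proof (cases "t \<in> {0..1}")
      case True
      have "(1 + t) powr ?p \<le> max 1 (2 powr ?p)"
      proof (cases "?p \<ge> 0")
        case True
        have "(1 + t) powr ?p \<le> 2 powr ?p"
          using True \<open>t \<in> {0..1}\<close> by (intro powr_mono2) auto
        then show ?thesis by simp
      next
        case False
        have "(1 + t) powr ?p \<le> (1 + t) powr 0"
          using False \<open>t \<in> {0..1}\<close> by (intro powr_mono) auto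
        then show ?thesis using True by auto
      qed
      moreover have "(1 - t\<^sup>2) powr ?p = (1 + t) powr ?p * (1 - t) powr ?p"
        using True powr_mult[of "1 + t" "1 - t" ?p]
        by (simp add: power2_eq_square algebra_simps)
      ultimately show ?thesis
        using True by (simp add: bessel_struve_weight_def mult_right_mono)
    qed (simp add: bessel_struve_weight_def)
    then show "AE t in lborel. norm (bessel_struve_weight \<beta> t)
        \<le> norm (max 1 (2 powr ?p) * (indicator {0..1} t *\<^sub>R (1 - t) powr ?p))"
      by simp
  qed
qed

context
  fixes \<beta> :: real
  assumes \<beta>: "\<beta> > -1/2"
begin

lemma bessel_struve_weight_facts:
  "integrable lborel (\<lambda>t. complex_of_real (bessel_struve_weight \<beta> t))"
  "(\<lambda>t. complex_of_real t) \<in> borel_measurable lborel"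
  "complex_of_real (bessel_struve_weight \<beta> t) \<noteq> 0 \<Longrightarrow> norm (complex_of_real t) \<le> 1"
  by (rule integrable_of_real[OF integrable_bessel_struve_weight[OF \<beta>]])
    (auto simp: bessel_struve_weight_def indicator_def split: if_splits)

lemmas weight_integral_facts =
  holomorphic_on_exp bessel_struve_weight_facts

lemma has_field_derivative_bessel_struve_entire:
  "(bessel_struve_entire \<beta> has_field_derivative of_real (bessel_struve_const \<beta>) *
     (LINT t|lborel. of_real (bessel_struve_weight \<beta> t) * (of_real t * exp (w * of_real t)))) (at w)"
  unfolding bessel_struve_entire_def
  using DERIV_cmult[OF has_field_derivative_integral_entire[OF weight_integral_facts],
      of "of_real (bessel_struve_const \<beta>)" w]
  by (simp add: DERIV_imp_deriv[OF DERIV_exp])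

lemma bessel_struve_entire_holomorphic: "bessel_struve_entire \<beta> holomorphic_on UNIV"
  using has_field_derivative_bessel_struve_entire
  by (auto simp: holomorphic_on_open)

lemma integrable_weight_exp:
  fixes w :: complex
  shows "integrable lborel (\<lambda>t. of_real (bessel_struve_weight \<beta> t) * exp (w * of_real t))"
  by (rule integrable_mult_entire[OF weight_integral_facts])

lemma integrable_weight_times_exp:
  fixes w :: complex
  shows "integrable lborel (\<lambda>t. of_real (bessel_struve_weight \<beta> t) * (of_real t * exp (w * of_real t)))"
  using integrable_mult_deriv_entire[OF weight_integral_facts]
  by (simp add: DERIV_imp_deriv[OF DERIV_exp])

end

text \<open>The two integrals are the product-rule terms of the derivative of \<open>?P\<close>, and
  the right-hand side is its boundary contribution: \<open>?P\<close> is 0 at \<open>t = 1\<close>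
  and -1 at \<open>t = 0\<close>.\<close>

lemma weight_integral_by_parts:
  fixes w :: complex
  assumes "\<beta> > -1/2"
  shows "of_real (2 * \<beta> + 1) *
      (LINT t|lborel. of_real (bessel_struve_weight \<beta> t) * (of_real t * exp (w * of_real t)))
    - w * (LINT t|lborel. of_real (bessel_struve_weight (\<beta> + 1) t) * exp (w * of_real t)) = 1"
proof -
  let ?k = "\<lambda>t. of_real (2 * \<beta> + 1) *
      (of_real (bessel_struve_weight \<beta> t) * (of_real t * exp (w * of_real t)))
    - w * (of_real (bessel_struve_weight (\<beta> + 1) t) * exp (w * of_real t))"
  let ?g = "\<lambda>t. of_real (2 * \<beta> + 1) *
      (of_real ((1 - t\<^sup>2) powr (\<beta> - 1/2)) * (of_real t * exp (w * of_real t)))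
    - w * (of_real ((1 - t\<^sup>2) powr (\<beta> + 1/2)) * exp (w * of_real t))"
  let ?P = "\<lambda>t. - of_real ((1 - t\<^sup>2) powr (\<beta> + 1/2)) * exp (w * of_real t)"
  have \<beta>1: "\<beta> + 1 > -1/2"
    using assms by simp
  note int = integrable_weight_times_exp[OF assms] integrable_weight_exp[OF \<beta>1]
  have k: "?k = (\<lambda>t. indicator {0..1} t *\<^sub>R ?g t)"
    by (auto simp: bessel_struve_weight_def indicator_def fun_eq_iff add.commute)
  \<comment> \<open>The derivative is taken in the open interval only, since \<open>?g\<close> may
    blow up at \<open>t = 1\<close> when \<open>\<beta> < 1/2\<close>.\<close>
  have hi: "(?g has_integral (?P 1 - ?P 0)) {0..1::real}"
  proof (rule fundamental_theorem_of_calculus_interior)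
    show "continuous_on {0..1} ?P"
      using assms
      by (intro continuous_intros continuous_on_powr') (auto simp: power_le_one)
    fix t :: real assume t: "t \<in> {0<..<1}"
    have pos: "1 - t\<^sup>2 > 0"
      using t by (simp add: power_less_one_iff abs_square_less_1)
    have d: "((\<lambda>t. (1 - t\<^sup>2) powr (\<beta> + 1/2)) has_real_derivative
        - (2 * \<beta> + 1) * t * (1 - t\<^sup>2) powr (\<beta> - 1/2)) (at t)"
      using pos by (auto intro!: derivative_eq_intros simp: powr_diff powr_add field_simps
          powr_half_sqrt)
    have e: "((\<lambda>t. exp (w * complex_of_real t)) has_vector_derivative
        w * exp (w * of_real t)) (at t)"
      by (rule has_vector_derivative_real_field[of "\<lambda>z. exp (w * z)"])
        (auto intro!: derivative_eq_intros)
    show "(?P has_vector_derivative ?g t) (at t)"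
      using has_vector_derivative_minus[OF has_vector_derivative_mult[OF
            has_vector_derivative_of_real[OF d] e]]
      by (simp add: algebra_simps)
  qed simp
  have si: "set_integrable lborel {0..1} ?g"
    unfolding set_integrable_def k[symmetric]
    using int by (intro Bochner_Integration.integrable_diff integrable_mult_right)
  have "(LINT t:{0..1}|lborel. ?g t) = ?P 1 - ?P 0"
    by (rule trans[OF set_borel_integral_eq_integral(2)[OF si] integral_unique[OF hi]])
  then have "(LINT t|lborel. ?k t) = 1"
    unfolding k set_lebesgue_integral_def by simp
  then show ?thesis
    using int by simp
qed

text \<open>Subtracting the integration by parts at 0 from that at \<open>w\<close> cancels the
  constant 1. The recurrence of the normalising constants then turns the prefactor of order
  \<open>\<beta>\<close> into that of order \<open>\<beta> + 1\<close>.\<close>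

lemma deriv_bessel_struve_entire_diff:
  assumes "\<beta> > -1/2"
  shows "deriv (bessel_struve_entire \<beta>) w - deriv (bessel_struve_entire \<beta>) 0
    = w * bessel_struve_entire (\<beta> + 1) w / of_real (2 * (\<beta> + 1))"
proof -
  let ?J = "\<lambda>w. LINT t|lborel. of_real (bessel_struve_weight \<beta> t) * (of_real t * exp (w * of_real t))"
  let ?I = "LINT t|lborel. of_real (bessel_struve_weight (\<beta> + 1) t) * exp (w * of_real t)"
  let ?c = "\<lambda>\<beta>. complex_of_real (bessel_struve_const \<beta>)"
  have d: "deriv (bessel_struve_entire \<beta>) w = ?c \<beta> * ?J w" for w
    by (rule DERIV_imp_deriv[OF has_field_derivative_bessel_struve_entire[OF assms]])
  have "of_real (2 * \<beta> + 1) * (?J w - ?J 0) = w * ?I"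
    using weight_integral_by_parts[OF assms, of w] weight_integral_by_parts[OF assms, of 0]
    by (simp add: algebra_simps)
  moreover have nz: "complex_of_real (2 * \<beta> + 1) \<noteq> 0" "complex_of_real (2 * (\<beta> + 1)) \<noteq> 0"
    using assms unfolding of_real_eq_0_iff by auto
  ultimately have J: "?J w - ?J 0 = w * ?I / of_real (2 * \<beta> + 1)"
    by (simp add: field_simps)
  have "bessel_struve_const (\<beta> + 1) * (2 * \<beta> + 1) = bessel_struve_const \<beta> * (2 * (\<beta> + 1))"
    using bessel_struve_const_Suc[OF assms] by (simp add: algebra_simps)
  then have c: "?c (\<beta> + 1) * of_real (2 * \<beta> + 1) = ?c \<beta> * of_real (2 * (\<beta> + 1))"
    by (metis of_real_mult)
  have "?c \<beta> / of_real (2 * \<beta> + 1) = ?c (\<beta> + 1) / of_real (2 * (\<beta> + 1))"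
    using c nz by (simp add: frac_eq_eq)
  moreover have "?c \<beta> * (?J w - ?J 0) = ?c \<beta> / of_real (2 * \<beta> + 1) * (w * ?I)"
    unfolding J by simp
  ultimately have "?c \<beta> * (?J w - ?J 0) = ?c (\<beta> + 1) / of_real (2 * (\<beta> + 1)) * (w * ?I)"
    by (simp only:)
  then show ?thesis
    unfolding d bessel_struve_entire_def right_diff_distrib[symmetric] by (simp add: mult_ac)
qed

section \<open>Test functions and the entire extension of the transform\<close>

lemma test_functions_continuous:
  assumes "f \<in> test_functions a"
  shows "continuous_on UNIV f"
proof -
  \<comment> \<open>The zeroth iterate is \<open>f\<close> itself.\<close>
  have "((\<lambda>u t. vector_derivative u (at t)) ^^ 0) f differentiable at x" for x
    using assms unfolding test_functions_def infinitely_differentiable_def by blast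
  then show ?thesis
    by (auto intro!: continuous_at_imp_continuous_on differentiable_imp_continuous_within)
qed

lemma test_functions_support:
  assumes "f \<in> test_functions a" and "f x \<noteq> 0"
  shows "x \<in> {-a..a}"
  using assms closure_subset[of "support_on UNIV f"]
  by (auto simp: test_functions_def support_on_def)

text \<open>Allows the factor -1/2 of the recurrence to be absorbed into the test function. Scaling
  commutes with every iterated derivative and does not enlarge the support.\<close>

lemma test_functions_cmult:
  assumes "f \<in> test_functions a"
  shows "(\<lambda>x. c * f x) \<in> test_functions a"
proof -
  let ?D = "\<lambda>u t. vector_derivative u (at t)"
  have smooth: "(?D ^^ n) f differentiable at x" for n x
    using assms unfolding test_functions_def infinitely_differentiable_def by blast
  have iter: "(?D ^^ n) (\<lambda>x. c * f x) = (\<lambda>x. c * (?D ^^ n) f x)" for n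
  proof (induction n)
    case (Suc n)
    have "vector_derivative (\<lambda>x. c * (?D ^^ n) f x) (at x)
        = c * vector_derivative ((?D ^^ n) f) (at x)" for x
      using has_vector_derivative_mult_right vector_derivative_works smooth
      by (intro vector_derivative_at) blast
    then show ?case
      using Suc by simp
  qed simp
  have "infinitely_differentiable (\<lambda>x. c * f x)"
    unfolding infinitely_differentiable_def iter using smooth
    by (auto intro!: differentiable_mult)
  moreover have "closure (support_on UNIV (\<lambda>x. c * f x)) \<subseteq> closure (support_on UNIV f)"
    by (intro closure_mono) (auto simp: support_on_def)
  ultimately show ?thesis
    using assms by (auto simp: test_functions_def)
qed

text \<open>The factors are grouped as a density times an entire function of
  \<open>z * (- \<i> * of_real x)\<close>, the shape required for differentiating under the
  integral.\<close>

definition bessel_struve_extension :: "real \<Rightarrow> (real \<Rightarrow> complex) \<Rightarrow> complex \<Rightarrow> complex" where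
  "bessel_struve_extension \<beta> f z =
     (LINT x|lborel. f x * of_real (\<bar>x\<bar> powr (2 * \<beta> + 1))
        * bessel_struve_entire \<beta> (z * (- \<i> * of_real x)))"

lemma bessel_struve_extension_of_real:
  "bessel_struve_extension \<beta> f (of_real y) = bessel_struve_transform \<beta> f y"
  by (simp add: bessel_struve_extension_def bessel_struve_transform_def bessel_struve_kernel_eq
      mult_ac)

lemma bessel_struve_extension_cmult:
  "bessel_struve_extension \<beta> (\<lambda>x. c * f x) z = c * bessel_struve_extension \<beta> f z"
  by (simp add: bessel_struve_extension_def mult.assoc)

context
  fixes \<beta> a :: real and f :: "real \<Rightarrow> complex"
  assumes \<beta>: "\<beta> > -1/2" and f: "f \<in> test_functions a"
begin

text \<open>Since \<open>2 * \<beta> + 1 > 0\<close>, the power of \<open>\<bar>x\<bar>\<close> is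
  continuous also at 0, so the density is continuous on \<open>[-a, a]\<close>; outside that
  interval \<open>f\<close> vanishes.\<close>

lemma transform_density_facts:
  "integrable lborel (\<lambda>x. f x * of_real (\<bar>x\<bar> powr (2 * \<beta> + 1)))"
  "(\<lambda>x. - \<i> * complex_of_real x) \<in> borel_measurable lborel"
  "f x * of_real (\<bar>x\<bar> powr (2 * \<beta> + 1)) \<noteq> 0 \<Longrightarrow> norm (- \<i> * complex_of_real x) \<le> a"
proof -
  have "set_integrable lborel {-a..a} (\<lambda>x. f x * of_real (\<bar>x\<bar> powr (2 * \<beta> + 1)))"
    using \<beta> continuous_on_subset[OF test_functions_continuous[OF f]]
    by (intro borel_integrable_atLeastAtMost' continuous_intros continuous_on_powr') auto
  moreover have "indicator {-a..a} x *\<^sub>R (f x * of_real (\<bar>x\<bar> powr (2 * \<beta> + 1)))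
      = f x * of_real (\<bar>x\<bar> powr (2 * \<beta> + 1))" for x
    using test_functions_support[OF f, of x] by (auto simp: indicator_def)
  ultimately show "integrable lborel (\<lambda>x. f x * of_real (\<bar>x\<bar> powr (2 * \<beta> + 1)))"
    unfolding set_integrable_def by simp
  show "norm (- \<i> * complex_of_real x) \<le> a" if "f x * of_real (\<bar>x\<bar> powr (2 * \<beta> + 1)) \<noteq> 0"
    using test_functions_support[OF f, of x] that by (auto simp: norm_mult)
qed simp

lemmas transform_integral_facts =
  bessel_struve_entire_holomorphic[OF \<beta>] transform_density_facts

lemma has_field_derivative_bessel_struve_extension:
  "(bessel_struve_extension \<beta> f has_field_derivative
     (LINT x|lborel. f x * of_real (\<bar>x\<bar> powr (2 * \<beta> + 1)) *
       (- \<i> * of_real x * deriv (bessel_struve_entire \<beta>) (z * (- \<i> * of_real x))))) (at z)"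
  unfolding bessel_struve_extension_def
  by (rule has_field_derivative_integral_entire[OF transform_integral_facts])

lemma bessel_struve_extension_holomorphic: "bessel_struve_extension \<beta> f holomorphic_on UNIV"
  using has_field_derivative_bessel_struve_extension by (auto simp: holomorphic_on_open)

lemma entire_extension_bessel_struve:
  "entire_extension (bessel_struve_transform \<beta> f) (bessel_struve_extension \<beta> f)"
  by (simp add: entire_extension_def bessel_struve_extension_holomorphic
      bessel_struve_extension_of_real)

text \<open>One factor \<open>- \<i> * x\<close> comes from the chain rule and one from the
  recurrence of the kernel. Their product \<open>- x\<^sup>2\<close> supplies the minus sign and
  raises the weight to that of order \<open>\<beta> + 1\<close>.\<close>

lemma deriv_bessel_struve_extension_diff:
  "deriv (bessel_struve_extension \<beta> f) z - deriv (bessel_struve_extension \<beta> f) 0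
    = - z * bessel_struve_extension (\<beta> + 1) f z / of_real (2 * (\<beta> + 1))"
proof -
  let ?k = "\<lambda>x. f x * complex_of_real (\<bar>x\<bar> powr (2 * \<beta> + 1))"
  let ?S = "deriv (bessel_struve_entire \<beta>)"
  let ?h = "\<lambda>z x. ?k x * (- \<i> * of_real x * ?S (z * (- \<i> * of_real x)))"
  let ?h1 = "\<lambda>x. f x * of_real (\<bar>x\<bar> powr (2 * (\<beta> + 1) + 1))
        * bessel_struve_entire (\<beta> + 1) (z * (- \<i> * of_real x))"
  have d: "deriv (bessel_struve_extension \<beta> f) z = (LINT x|lborel. ?h z x)" for z
    by (rule DERIV_imp_deriv[OF has_field_derivative_bessel_struve_extension])
  have pointwise: "?h z x - ?h 0 x = - z / of_real (2 * (\<beta> + 1)) * ?h1 x" for x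
  proof -
    have p: "\<bar>x\<bar> powr (2 * (\<beta> + 1) + 1) = \<bar>x\<bar> powr (2 * \<beta> + 1) * x\<^sup>2"
      using powr_add[of "\<bar>x\<bar>" "2 * \<beta> + 1" 2] by (cases "x = 0") (auto simp: add_ac)
    have "?h z x - ?h 0 x = ?k x * (- \<i> * of_real x) * (?S (z * (- \<i> * of_real x)) - ?S 0)"
      by (simp add: algebra_simps)
    also have "\<dots> = ?k x * (- \<i> * of_real x) * (z * (- \<i> * of_real x)
        * bessel_struve_entire (\<beta> + 1) (z * (- \<i> * of_real x)) / of_real (2 * (\<beta> + 1)))"
      by (simp only: deriv_bessel_struve_entire_diff[OF \<beta>])
    also have "\<dots> = - z / of_real (2 * (\<beta> + 1)) * ?h1 x"
      unfolding p by (simp add: power2_eq_square mult_ac)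
    finally show ?thesis .
  qed
  have int: "integrable lborel (?h z)" for z
    by (rule integrable_mult_deriv_entire[OF transform_integral_facts])
  have "deriv (bessel_struve_extension \<beta> f) z - deriv (bessel_struve_extension \<beta> f) 0
      = (LINT x|lborel. ?h z x - ?h 0 x)"
    unfolding d by (rule Bochner_Integration.integral_diff[OF int int, symmetric])
  also have "\<dots> = - z / of_real (2 * (\<beta> + 1)) * (LINT x|lborel. ?h1 x)"
    unfolding pointwise by (rule integral_mult_right_zero)
  finally show ?thesis
    by (simp add: bessel_struve_extension_def)
qed

end

section \<open>Uniqueness of entire functions, and the equivalence\<close>

lemma entire_extension_unique:
  assumes "entire_extension g F" and "entire_extension g G"
  shows "F = G"
proof
  fix z
  have "F z - G z = 0"
  \<comment> \<open>Identity theorem: the difference vanishes on the real axis, which accumulates at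
    0.\<close>
  proof (rule analytic_continuation[of "\<lambda>z. F z - G z" UNIV \<real> 0])
    show "(0::complex) islimpt \<real>"
      unfolding islimpt_approachable
    proof (intro allI impI)
      fix e :: real assume "e > 0"
      then show "\<exists>x'\<in>\<real>. x' \<noteq> (0::complex) \<and> dist x' 0 < e"
        by (intro bexI[of _ "of_real (e/2)"]) auto
    qed
    show "F w - G w = 0" if "w \<in> \<real>" for w
      using that assms by (auto simp: entire_extension_def elim!: Reals_cases)
  qed (use assms in \<open>auto simp: entire_extension_def intro: holomorphic_on_diff\<close>)
  then show "F z = G z" by simp
qed

text \<open>At \<open>p\<close> both values are limits of the same punctured function. This fills in
  \<open>z = 0\<close>, where the formula for \<open>G\<close> says nothing.\<close>

lemma holomorphic_eq_off_point:
  assumes "F holomorphic_on UNIV" and "G holomorphic_on UNIV"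
    and "\<And>z. z \<noteq> (p::complex) \<Longrightarrow> F z = G z"
  shows "F = G"
proof
  fix z
  have "F \<midarrow>p\<rightarrow> F p" "G \<midarrow>p\<rightarrow> G p"
    using assms(1,2)[THEN holomorphic_on_imp_continuous_on]
    by (auto simp: continuous_on_eq_continuous_at isCont_def)
  moreover have "F \<midarrow>p\<rightarrow> G p \<longleftrightarrow> G \<midarrow>p\<rightarrow> G p"
    using assms(3) by (intro LIM_equal) auto
  ultimately have "F p = G p"
    using LIM_unique by blast
  then show "F z = G z"
    using assms(3) by (cases "z = p") auto
qed

theorem proposition4p3:
  fixes \<alpha> a :: real and g :: "real \<Rightarrow> complex"
  assumes "\<alpha> > 1/2" and "a > 0"
  shows "(\<exists>f\<in>test_functions a. g = bessel_struve_transform \<alpha> f) \<longleftrightarrow>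
    (\<exists>G. entire_extension g G \<and>
      (\<exists>h\<in>entire_bessel_struve_image (\<alpha> - 1) a.
        \<forall>z. z \<noteq> 0 \<longrightarrow> G z = of_real \<alpha> * ((deriv h z - deriv h 0) / z)))"
    (is "?lhs \<longleftrightarrow> ?rhs")
proof -
  let ?E = bessel_struve_extension
  have \<beta>: "\<alpha> - 1 > -1/2" and \<alpha>: "\<alpha> > -1/2"
    using assms by auto
  \<comment> \<open>At order \<open>\<alpha> - 1\<close> the denominator of the recurrence is
    \<open>2 * \<alpha>\<close>, so \<open>\<alpha>\<close> cancels and only -1/2 remains.\<close>
  have key: "of_real \<alpha> * ((deriv (?E (\<alpha> - 1) f) z - deriv (?E (\<alpha> - 1) f) 0) / z)
      = ?E \<alpha> (\<lambda>x. - 1/2 * f x) z"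
    if "f \<in> test_functions a" "z \<noteq> 0" for f z
    using assms that deriv_bessel_struve_extension_diff[OF \<beta> that(1), of z]
    unfolding bessel_struve_extension_cmult by simp
  show ?thesis
  proof
    assume ?lhs
    then obtain f where f: "f \<in> test_functions a" "g = bessel_struve_transform \<alpha> f"
      by blast
    \<comment> \<open>Chosen so that the factor -1/2 in \<open>key\<close> returns
      \<open>f\<close>.\<close>
    let ?f = "\<lambda>x. - 2 * f x"
    have tf: "?f \<in> test_functions a"
      by (rule test_functions_cmult[OF f(1)])
    show ?rhs
    proof (intro exI[of _ "?E \<alpha> f"] conjI bexI[of _ "?E (\<alpha> - 1) ?f"] allI impI)
      show "entire_extension g (?E \<alpha> f)"
        unfolding f(2) by (rule entire_extension_bessel_struve[OF \<alpha> f(1)])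
      show "?E (\<alpha> - 1) ?f \<in> entire_bessel_struve_image (\<alpha> - 1) a"
        unfolding entire_bessel_struve_image_def
        using tf entire_extension_bessel_struve[OF \<beta> tf] by blast
      show "?E \<alpha> f z = of_real \<alpha> * ((deriv (?E (\<alpha> - 1) ?f) z - deriv (?E (\<alpha> - 1) ?f) 0) / z)"
        if "z \<noteq> 0" for z
        using key[OF tf that] by simp
    qed
  next
    assume ?rhs
    then obtain G h f where G: "entire_extension g G"
      and f: "f \<in> test_functions a" and h: "entire_extension (bessel_struve_transform (\<alpha> - 1) f) h"
      and eq: "\<And>z. z \<noteq> 0 \<Longrightarrow> G z = of_real \<alpha> * ((deriv h z - deriv h 0) / z)"
      unfolding entire_bessel_struve_image_def by blast
    let ?f = "\<lambda>x. - 1/2 * f x"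
    have tf: "?f \<in> test_functions a"
      by (rule test_functions_cmult[OF f])
    \<comment> \<open>\<open>h\<close> is given only as some entire extension; uniqueness makes it
      the integral formula, to which \<open>key\<close> applies.\<close>
    have "h = ?E (\<alpha> - 1) f"
      by (rule entire_extension_unique[OF h entire_extension_bessel_struve[OF \<beta> f]])
    then have "G = ?E \<alpha> ?f"
      using G eq key[OF f]
      by (intro holomorphic_eq_off_point[where p = 0] bessel_struve_extension_holomorphic[OF \<alpha> tf])
        (auto simp: entire_extension_def)
    then have "g = bessel_struve_transform \<alpha> ?f"
      using G by (auto simp: entire_extension_def bessel_struve_extension_of_real[symmetric])
    then show ?lhs
      using tf by blast
  qed
qed

end
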